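(* There exist a sequence of graphons $(\Omega,\mu,W_n)_{n\in\mathbb{N}}$ and some numerical constants $p,c,c'>0$ such that the following holds for any estimator $\widehat d$ and any permutation $\sigma$ of the $n$ indices $\{1,\dots,n\}$. With probability larger than $p$, the lower bound $$\left|r_{W_n}^2(\omega_i,\omega_j)-\widehat d^{\,2}(\sigma(i),\sigma(j))\right|\ge c'\left(r_{W_n}(\omega_j,\omega_{m(j)})+r_{W_n}(\omega_i,\omega_{m(i)})+\sqrt{\frac{\log n}{n}}\right)$$ is satisfied for (at least) $c\,n$ different pairs $(i,j)$.
   Context: A graphon is a triplet $(\Omega,\mu,W)$ where $\Omega$ is a measurable space, $\mu$ a probability measure on $\Omega$ and $W:\Omega\times\Omega\to[0,1]$ a symmetric measurable function. Neighborhood distance: $r_W(\omega,\omega')=\big(\int_\Omega |W(\omega,z)-W(\omega',z)|^2\mu(dz)\big)^{1/2}$. For each sample size $n$, the data are generated by the $W$-random graph model on $n$ nodes with parameter $(\Omega,\mu,W_n)$: $\omega_1,\dots,\omega_n$ are i.i.d. with law $\mu$ (unobserved); conditionally on them, the entries $A_{ij}$, $i<j$, are independent Bernoulli with parameters $W_n(\omega_i,\omega_j)$; $A_{ji}=A_{ij}$, $A_{ii}=0$. The probability in the claim is with respect to this model. An estimator $\widehat d$ is a function of the adjacency matrix $A$ returning an array $(\widehat d(i,j))_{i,j\le n}$; $\widehat d^{\,2}(i,j)=\widehat d(i,j)^2$. For each $i$, $m(i)\in\operatorname{argmin}_{t\ne i}r_{W_n}(\omega_i,\omega_t)$ is the index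 of a nearest neighbor of $\omega_i$ in the sample. *)

theory Defs
  imports "HOL-Probability.Probability"
begin

definition graphon :: "'a measure \<Rightarrow> ('a \<Rightarrow> 'a \<Rightarrow> real) \<Rightarrow> bool" where
  "graphon M W \<longleftrightarrow>
     prob_space M \<and>
     case_prod W \<in> borel_measurable (M \<Otimes>\<^sub>M M) \<and>
     (\<forall>x\<in>space M. \<forall>y\<in>space M. W x y = W y x \<and> 0 \<le> W x y \<and> W x y \<le> 1)"

definition nb_dist :: "'a measure \<Rightarrow> ('a \<Rightarrow> 'a \<Rightarrow> real) \<Rightarrow> 'a \<Rightarrow> 'a \<Rightarrow> real" where
  "nb_dist M W x y = sqrt (\<integral>z. \<bar>W x z - W y z\<bar>\<^sup>2 \<partial>M)"

text \<open>Ties are broken by Hilbert choice; only the minimal distance itself matters below.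
  The minimum is over an empty set, hence meaningless, unless \<open>n \<ge> 2\<close>.\<close>

definition nearest :: "'a measure \<Rightarrow> ('a \<Rightarrow> 'a \<Rightarrow> real) \<Rightarrow> nat \<Rightarrow> (nat \<Rightarrow> 'a) \<Rightarrow> nat \<Rightarrow> nat" where
  "nearest M W n \<omega> i = arg_min_on (\<lambda>t. nb_dist M W (\<omega> i) (\<omega> t)) ({1..n} - {i})"

definition upper_pairs :: "nat \<Rightarrow> (nat \<times> nat) set" where
  "upper_pairs n = {(i, j). 1 \<le> i \<and> i < j \<and> j \<le> n}"

definition symmetrize :: "(nat \<times> nat \<Rightarrow> bool) \<Rightarrow> nat \<Rightarrow> nat \<Rightarrow> bool" where
  "symmetrize B i j = (if i < j then B (i, j) else if j < i then B (j, i) else False)"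

text \<open>The conditional law of the adjacency matrix given the latent positions \<open>\<omega>\<close>.
  Entries with an index outside \<open>{1..n}\<close> are \<open>False\<close>.\<close>

definition adj_pmf :: "nat \<Rightarrow> ('a \<Rightarrow> 'a \<Rightarrow> real) \<Rightarrow> (nat \<Rightarrow> 'a) \<Rightarrow> (nat \<Rightarrow> nat \<Rightarrow> bool) pmf" where
  "adj_pmf n W \<omega> =
     map_pmf symmetrize
       (Pi_pmf (upper_pairs n) False (\<lambda>(i, j). bernoulli_pmf (W (\<omega> i) (\<omega> j))))"

text \<open>The joint law of the latent positions and the adjacency matrix. The kernel is measurable
  for a graphon (\<open>w_random_kernel_measurable\<close>), so the bind has its intended meaning.\<close>

definition sample_space :: "nat \<Rightarrow> 'a measure \<Rightarrow> ((nat \<Rightarrow> 'a) \<times> (nat \<Rightarrow> nat \<Rightarrow> bool)) measure" where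
  "sample_space n M = (\<Pi>\<^sub>M i\<in>{1..n}. M) \<Otimes>\<^sub>M count_space UNIV"

definition w_random_graph ::
  "nat \<Rightarrow> 'a measure \<Rightarrow> ('a \<Rightarrow> 'a \<Rightarrow> real) \<Rightarrow> ((nat \<Rightarrow> 'a) \<times> (nat \<Rightarrow> nat \<Rightarrow> bool)) measure" where
  "w_random_graph n M W =
     (\<Pi>\<^sub>M i\<in>{1..n}. M) \<bind> (\<lambda>\<omega>. distr (measure_pmf (adj_pmf n W \<omega>)) (sample_space n M) (Pair \<omega>))"

lemma finite_upper_pairs: "finite (upper_pairs n)"
  by (rule finite_subset[of _ "{1..n} \<times> {1..n}"]) (auto simp: upper_pairs_def)

lemma adj_pmf_measurable:
  assumes "graphon M W"
  shows "(\<lambda>\<omega>. measure_pmf (adj_pmf n W \<omega>))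
           \<in> (\<Pi>\<^sub>M i\<in>{1..n}. M) \<rightarrow>\<^sub>M subprob_algebra (count_space UNIV)"
proof (rule measurable_subprob_algebra)
  let ?P = "\<Pi>\<^sub>M i\<in>{1..n}. M"
  let ?F = "PiE_dflt (upper_pairs n) False (\<lambda>_. UNIV :: bool set)"
  have finF: "finite ?F"
    by (intro finite_PiE_dflt finite_upper_pairs) auto
  have W [measurable]: "case_prod W \<in> borel_measurable (M \<Otimes>\<^sub>M M)"
    using assms by (simp add: graphon_def)
  fix B :: "(nat \<Rightarrow> nat \<Rightarrow> bool) set"
  define S where "S = symmetrize -` B \<inter> ?F"
  have finS: "finite S" using finF by (simp add: S_def)
  have eq: "emeasure (measure_pmf (adj_pmf n W \<omega>)) B =
      ennreal (\<Sum>x\<in>S. \<Prod>(i,j)\<in>upper_pairs n.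
        (if x (i,j) then W (\<omega> i) (\<omega> j) else 1 - W (\<omega> i) (\<omega> j)))"
    if w: "\<omega> \<in> space ?P" for \<omega>
  proof -
    let ?p = "Pi_pmf (upper_pairs n) False (\<lambda>(i, j). bernoulli_pmf (W (\<omega> i) (\<omega> j)))"
    have sub: "set_pmf ?p \<subseteq> ?F"
      by (rule order_trans[OF set_Pi_pmf_subset[OF finite_upper_pairs]])
         (auto simp: PiE_dflt_def)
    have "emeasure (measure_pmf (adj_pmf n W \<omega>)) B = emeasure (measure_pmf ?p) (symmetrize -` B)"
      by (simp add: adj_pmf_def)
    also have "\<dots> = emeasure (measure_pmf ?p) S"
      unfolding S_def using sub by (intro emeasure_eq_AE) (auto simp: AE_measure_pmf_iff)
    also have "\<dots> = ennreal (\<Sum>x\<in>S. pmf ?p x)"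
      using finS by (simp add: emeasure_measure_pmf_finite)
    also have "(\<Sum>x\<in>S. pmf ?p x) = (\<Sum>x\<in>S. \<Prod>(i,j)\<in>upper_pairs n.
        (if x (i,j) then W (\<omega> i) (\<omega> j) else 1 - W (\<omega> i) (\<omega> j)))"
    proof (rule sum.cong[OF refl])
      fix x assume "x \<in> S"
      then have "x \<in> ?F" by (simp add: S_def)
      then have out: "\<And>q. q \<notin> upper_pairs n \<Longrightarrow> x q = False"
        by (auto simp: PiE_dflt_def)
      have "pmf ?p x = (\<Prod>q\<in>upper_pairs n.
          pmf (case q of (i, j) \<Rightarrow> bernoulli_pmf (W (\<omega> i) (\<omega> j))) (x q))"
        by (intro pmf_Pi' finite_upper_pairs out)
      also have "\<dots> = (\<Prod>(i,j)\<in>upper_pairs n.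
        (if x (i,j) then W (\<omega> i) (\<omega> j) else 1 - W (\<omega> i) (\<omega> j)))"
      proof (rule prod.cong[OF refl], clarify)
        fix i j assume "(i, j) \<in> upper_pairs n"
        then have "i \<in> {1..n}" "j \<in> {1..n}" by (auto simp: upper_pairs_def)
        then have "\<omega> i \<in> space M" "\<omega> j \<in> space M" using w by (auto simp: space_PiM)
        then have "0 \<le> W (\<omega> i) (\<omega> j)" "W (\<omega> i) (\<omega> j) \<le> 1"
          using assms by (auto simp: graphon_def)
        then show "pmf (bernoulli_pmf (W (\<omega> i) (\<omega> j))) (x (i, j)) =
            (if x (i, j) then W (\<omega> i) (\<omega> j) else 1 - W (\<omega> i) (\<omega> j))"
          by (cases "x (i, j)") auto
      qed
      finally show "pmf ?p x = (\<Prod>(i,j)\<in>upper_pairs n.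
        (if x (i,j) then W (\<omega> i) (\<omega> j) else 1 - W (\<omega> i) (\<omega> j)))" .
    qed
    finally show ?thesis .
  qed
  have meas: "(\<lambda>\<omega>. W (\<omega> i) (\<omega> j)) \<in> borel_measurable ?P"
    if "(i, j) \<in> upper_pairs n" for i j
  proof -
    have [measurable]: "i \<in> {1..n}" "j \<in> {1..n}" using that by (auto simp: upper_pairs_def)
    show ?thesis by measurable
  qed
  have "(\<lambda>\<omega>. ennreal (\<Sum>x\<in>S. \<Prod>(i,j)\<in>upper_pairs n.
        (if x (i,j) then W (\<omega> i) (\<omega> j) else 1 - W (\<omega> i) (\<omega> j)))) \<in> borel_measurable ?P"
    unfolding case_prod_beta
    apply (intro measurable_compose[OF _ measurable_ennreal] borel_measurable_sum borel_measurable_prod)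
    subgoal for x q using meas[of "fst q" "snd q"] by auto
    done
  then show "(\<lambda>\<omega>. emeasure (measure_pmf (adj_pmf n W \<omega>)) B) \<in> borel_measurable ?P"
    by (subst measurable_cong[OF eq]) auto
qed (auto intro: prob_space_imp_subprob_space prob_space_measure_pmf)

lemma w_random_kernel_measurable:
  assumes "graphon M W"
  shows "(\<lambda>\<omega>. distr (measure_pmf (adj_pmf n W \<omega>)) (sample_space n M) (Pair \<omega>))
           \<in> (\<Pi>\<^sub>M i\<in>{1..n}. M) \<rightarrow>\<^sub>M subprob_algebra (sample_space n M)"
  by (rule measurable_distr2[OF _ adj_pmf_measurable[OF assms]])
     (auto simp: sample_space_def space_pair_measure)

lemma prob_space_w_random_graph:
  assumes "graphon M W"
  shows "prob_space (w_random_graph n M W)"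
    and "sets (w_random_graph n M W) = sets (sample_space n M)"
proof -
  interpret prob_space M using assms by (simp add: graphon_def)
  interpret P: prob_space "\<Pi>\<^sub>M i\<in>{1..n}. M"
    by (intro prob_space_PiM) (rule prob_space_axioms)
  note K = w_random_kernel_measurable[OF assms, of n]
  show "prob_space (w_random_graph n M W)"
    unfolding w_random_graph_def
    by (rule P.prob_space_bind[OF AE_I2 K])
       (auto intro!: prob_space.prob_space_distr prob_space_measure_pmf simp: sample_space_def space_pair_measure)
  show "sets (w_random_graph n M W) = sets (sample_space n M)"
    unfolding w_random_graph_def
    by (rule sets_bind[OF _ P.not_empty]) simp
qed

end

theory Submission imports Defs begin

text \<open>The nearest neighbor distances on the right-hand side are allowed to be of constant order, so it
  suffices that a constant error be unavoidable for a constant fraction of all pairs. Take a graphon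
  with values in \<open>{0, 1/2, 1}\<close> and nodes of two kinds that \<open>A\<close> cannot tell apart: towards a probe, a
  node of kind 0 connects with probability \<open>1/2\<close>, whereas a node of kind 1 connects deterministically
  according to a hidden uniformly random bit string read at the random position of the probe. With
  \<open>N \<ge> 6 n\<^sup>2\<close> positions the probes in the sample are distinct with high probability, and then the
  average over the hidden string makes the row of a node of kind 1 a row of fair coins. But
  \<open>r\<^sup>2 = 0\<close> between two nodes of kind 0 and \<open>r\<^sup>2 = 1/12\<close> between kinds 0 and 1, so no estimate is within
  \<open>1/24\<close> of both. Each pair thus fails with probability at least \<open>1/18\<close>, and a reverse Markov
  inequality for the number of failing pairs concludes.\<close>

section \<open>Reading a uniform random subset at distinct points\<close>

text \<open>As \<open>w\<close> is injective on \<open>K\<close>, the demands at different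
  \<open>q\<close> never conflict. They fix \<open>V\<close> on the image of \<open>K\<close> and
  leave it free elsewhere, so \<open>V\<close> is \<open>?T\<close> together with an arbitrary
  subset of the complement.\<close>

lemma card_subsets_with_trace:
  assumes "finite X" "inj_on w K" "w ` K \<subseteq> X"
  shows "card {V \<in> Pow X. \<forall>q\<in>K. w q \<in> V \<longleftrightarrow> B q} = 2 ^ (card X - card K)"
proof -
  let ?T = "w ` {q \<in> K. B q}"
  have "bij_betw (\<lambda>V. V \<union> ?T) (Pow (X - w ` K)) {V \<in> Pow X. \<forall>q\<in>K. w q \<in> V \<longleftrightarrow> B q}"
  proof (rule bij_betw_byWitness[where f' = "\<lambda>V. V - w ` K"])
    show "(\<lambda>V. V \<union> ?T) ` Pow (X - w ` K) \<subseteq> {V \<in> Pow X. \<forall>q\<in>K. w q \<in> V \<longleftrightarrow> B q}"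
      using assms(2,3) by (auto dest: inj_onD)
  qed (use assms(3) in auto)
  then have "card {V \<in> Pow X. \<forall>q\<in>K. w q \<in> V \<longleftrightarrow> B q} = card (Pow (X - w ` K))"
    by (simp add: bij_betw_same_card)
  also have "\<dots> = 2 ^ card (X - w ` K)" using assms(1) by (simp add: card_Pow)
  also have "card (X - w ` K) = card X - card K"
    using assms by (simp add: card_Diff_subset card_image finite_subset)
  finally show ?thesis .
qed

text \<open>Unnormalised form of a fact about coins: the bits of a uniform subset of
  \<open>X\<close>, read at distinct points, are independent and fair. The product of indicators is
  the indicator of one prescribed trace.\<close>

lemma sum_prod_indicator_Pow:
  fixes w :: "'b \<Rightarrow> 'a"
  assumes "finite X" "inj_on w K" "w ` K \<subseteq> X"
  shows "(\<Sum>V\<in>Pow X. \<Prod>q\<in>K. of_bool (w q \<in> V \<longleftrightarrow> B q) :: real) = 2 ^ card X * (1 / 2) ^ card K"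
proof -
  have fin: "finite K" using assms by (metis finite_imageD finite_subset)
  \<comment> \<open>Makes the natural number subtraction in the exponent
    \<open>card X - card K\<close> exact.\<close>
  have "card K \<le> card X" using assms by (metis card_image card_mono)
  have *: "(\<Prod>q\<in>K. of_bool (w q \<in> V \<longleftrightarrow> B q) :: real) = of_bool (\<forall>q\<in>K. w q \<in> V \<longleftrightarrow> B q)" for V
    using fin by (auto simp: prod_zero_iff)
  have "(\<Sum>V\<in>Pow X. \<Prod>q\<in>K. of_bool (w q \<in> V \<longleftrightarrow> B q) :: real)
      = real (card {V \<in> Pow X. \<forall>q\<in>K. w q \<in> V \<longleftrightarrow> B q})"
    unfolding * using assms(1) by (simp add: of_bool_def sum.If_cases Int_def)
  also have "\<dots> = 2 ^ card X * (1 / 2) ^ card K"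
    using \<open>card K \<le> card X\<close>
    by (simp only: card_subsets_with_trace[OF assms] of_nat_power) (simp add: power_diff power_one_over)
  finally show ?thesis .
qed

section \<open>Labelled nodes and the hidden mask\<close>

text \<open>A label is a triple of a kind, a mask and a position. Kind 0 is the featureless kind, kind 1
  reads its mask at the positions of the nodes of kind 2, the probes. Every node carries a mask and
  a position, so that a uniform label has independent components.\<close>

type_synonym label = "nat \<times> nat set \<times> nat"

definition labels :: "nat \<Rightarrow> label set" where
  "labels N = {..<3} \<times> Pow {..<N} \<times> {..<N}"

abbreviation kind :: "label \<Rightarrow> nat" where
  "kind x \<equiv> fst x"

abbreviation mask :: "label \<Rightarrow> nat set" where
  "mask x \<equiv> fst (snd x)"

abbreviation position :: "label \<Rightarrow> nat" where
  "position x \<equiv> snd (snd x)"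

definition link :: "label \<Rightarrow> label \<Rightarrow> real" where
  "link x y =
     (if kind x = 1 \<and> kind y = 2 then of_bool (position y \<in> mask x)
      else if kind x = 2 \<and> kind y = 1 then of_bool (position x \<in> mask y)
      else 1 / 2)"

lemma link_commute: "link x y = link y x"
  by (simp add: link_def)

lemma link_bounds: "0 \<le> link x y" "link x y \<le> 1"
  by (simp_all add: link_def)

text \<open>The entries of row \<open>j\<close> towards distinct probes read distinct bits of the uniform mask, hence
  are independent fair coins, exactly as for a node of kind 0.\<close>

lemma adj_pmf_average_mask:
  assumes inj: "inj_on (\<lambda>l. position (g l)) ({1..n} - {j})"
    and pos: "\<And>l. l \<in> {1..n} - {j} \<Longrightarrow> position (g l) < N"
  shows "bind_pmf (pmf_of_set (Pow {..<N})) (\<lambda>V. adj_pmf n link (g(j := (1, V, u))))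
    = adj_pmf n link (g(j := (0, U, v)))"
proof -
  let ?E = "upper_pairs n"
  \<comment> \<open>\<open>p x q\<close> is the coin of the pair \<open>q\<close> when node
    \<open>j\<close> carries label \<open>x\<close>. For \<open>q\<close> containing
    \<open>j\<close>, \<open>other q\<close> is the second endpoint. \<open>K\<close> collects the
    pairs that join \<open>j\<close> to a probe; these are the only pairs whose coin distinguishes
    kinds 0 and 1 of node \<open>j\<close>.\<close>
  define p where "p x = (\<lambda>(i, k). bernoulli_pmf (link ((g(j := x)) i) ((g(j := x)) k)))" for x
  define other where "other = (\<lambda>(i, k). if i = j then k else i)"
  define K where "K = {q \<in> ?E. (fst q = j \<or> snd q = j) \<and> kind (g (other q)) = 2}"
  have KE: "K \<subseteq> ?E" by (auto simp: K_def)
  have other: "other q \<in> {1..n} - {j}" if "q \<in> K" for q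
    using that by (auto simp: K_def other_def upper_pairs_def split: prod.splits if_splits)
  have "inj_on other K"
    by (auto simp: inj_on_def K_def other_def upper_pairs_def split: if_splits)
  then have injK: "inj_on (\<lambda>q. position (g (other q))) K"
    using comp_inj_on[OF _ inj_on_subset[OF inj image_subsetI[OF other]]] by (simp add: comp_def)
  have posK: "(\<lambda>q. position (g (other q))) ` K \<subseteq> {..<N}"
    using other pos by auto
  have pK: "pmf (p (1, V, u) q) b = of_bool (position (g (other q)) \<in> V \<longleftrightarrow> b)" if "q \<in> K" for q V b
    using that by (cases b) (auto simp: K_def p_def other_def upper_pairs_def link_def split: prod.splits if_splits)
  have p0: "pmf (p (0, U, v) q) b = 1 / 2" if "q \<in> K" for q b
    using that by (cases b) (auto simp: K_def p_def other_def upper_pairs_def link_def split: prod.splits if_splits)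
  have pN: "p (1, V, u) q = p (0, U, v) q" if "q \<in> ?E - K" for q V
    using that by (cases q) (auto simp: K_def p_def other_def upper_pairs_def link_def)
  have "bind_pmf (pmf_of_set (Pow {..<N})) (\<lambda>V. Pi_pmf ?E False (p (1, V, u))) = Pi_pmf ?E False (p (0, U, v))"
  proof (rule pmf_eqI)
    fix B :: "nat \<times> nat \<Rightarrow> bool"
    show "pmf (bind_pmf (pmf_of_set (Pow {..<N})) (\<lambda>V. Pi_pmf ?E False (p (1, V, u)))) B
      = pmf (Pi_pmf ?E False (p (0, U, v))) B"
    \<comment> \<open>A configuration that is not \<open>False\<close> off \<open>?E\<close> has
      mass zero on both sides, since \<open>False\<close> is the default value of
      \<open>Pi_pmf\<close>.\<close>
    proof (cases "\<forall>q. q \<notin> ?E \<longrightarrow> B q = False")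
      case True
      have Pi: "pmf (Pi_pmf ?E False (p x)) B
          = (\<Prod>q\<in>K. pmf (p x q) (B q)) * (\<Prod>q\<in>?E - K. pmf (p x q) (B q))" for x
        using True prod.subset_diff[OF KE finite_upper_pairs, of "\<lambda>q. pmf (p x q) (B q)"]
        by (subst pmf_Pi'[OF finite_upper_pairs]) (auto simp: mult.commute)
      have "pmf (bind_pmf (pmf_of_set (Pow {..<N})) (\<lambda>V. Pi_pmf ?E False (p (1, V, u)))) B
        = (\<Sum>V\<in>Pow {..<N}. pmf (Pi_pmf ?E False (p (1, V, u))) B) / 2 ^ N"
        by (simp add: pmf_bind integral_pmf_of_set card_Pow Pow_not_empty)
      also have "(\<Sum>V\<in>Pow {..<N}. pmf (Pi_pmf ?E False (p (1, V, u))) B)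
        = (\<Sum>V\<in>Pow {..<N}. (\<Prod>q\<in>K. of_bool (position (g (other q)) \<in> V \<longleftrightarrow> B q))
            * (\<Prod>q\<in>?E - K. pmf (p (0, U, v) q) (B q)))"
        unfolding Pi by (intro sum.cong refl arg_cong2[where f="(*)"] prod.cong) (simp_all add: pK pN del: One_nat_def)
      \<comment> \<open>The factor over \<open>?E - K\<close> is free of \<open>V\<close>. By
        injectivity of the positions read, the sum over masks gives each bit on \<open>K\<close> the
        weight \<open>1 / 2\<close> of a fair coin.\<close>
      also have "\<dots> = 2 ^ N * (1 / 2) ^ card K * (\<Prod>q\<in>?E - K. pmf (p (0, U, v) q) (B q))"
        unfolding sum_distrib_right[symmetric]
        by (subst sum_prod_indicator_Pow[OF _ injK posK]) auto
      also have "\<dots> / 2 ^ N = pmf (Pi_pmf ?E False (p (0, U, v))) B"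
        unfolding Pi by (simp add: p0)
      finally show ?thesis .
    next
      case False
      then have "pmf (Pi_pmf ?E False (p x)) B = 0" for x
        by (subst pmf_Pi[OF finite_upper_pairs]) auto
      then show ?thesis by (simp add: pmf_bind)
    qed
  qed
  moreover have "adj_pmf n link (g(j := x)) = map_pmf symmetrize (Pi_pmf ?E False (p x))" for x
    by (simp add: adj_pmf_def p_def)
  ultimately show ?thesis
    by (simp only: map_bind_pmf[symmetric])
qed

section \<open>Finite uniform laws on the unit interval\<close>

definition unit_uniform :: "real measure" where
  "unit_uniform = uniform_measure lborel {0..<1}"

lemma prob_space_unit_uniform: "prob_space unit_uniform"
  unfolding unit_uniform_def by (rule prob_space_uniform_measure) auto

text \<open>Cut the unit interval into \<open>card S\<close> cells of equal length and send each
  cell to one element of \<open>S\<close>. This lets a single probability space carry the uniform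
  labels of every sample size, as the fixed measure of the theorem requires.\<close>

lemma unit_uniform_map_onto_finite:
  assumes S: "finite S" "S \<noteq> {}"
  shows "\<exists>h. range h \<subseteq> S \<and> h \<in> unit_uniform \<rightarrow>\<^sub>M count_space UNIV \<and>
    distr unit_uniform (count_space UNIV) h = measure_pmf (pmf_of_set S)"
proof -
  define L where "L = card S"
  have L: "L > 0" using S by (simp add: L_def card_gt_0_iff)
  obtain e where e: "bij_betw e {..<L} S"
    using S ex_bij_betw_nat_finite[OF S(1)] by (auto simp: L_def atLeast0LessThan)
  \<comment> \<open>The reduction modulo \<open>L\<close> keeps \<open>h\<close> inside
    \<open>S\<close> on the whole real line, including the null set outside
    \<open>{0..<1}\<close>.\<close>
  define r where "r x = nat \<lfloor>real L * x\<rfloor> mod L" for x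
  define h where "h = e \<circ> r"
  have rL: "r x < L" for x using L by (simp add: r_def)
  have range: "range h \<subseteq> S" using e rL by (auto simp: h_def bij_betw_def)
  have [measurable]: "r \<in> borel \<rightarrow>\<^sub>M count_space UNIV" unfolding r_def by measurable
  have hm: "h \<in> unit_uniform \<rightarrow>\<^sub>M count_space UNIV"
    unfolding h_def
    by (rule measurable_comp[where N="count_space UNIV"]) (simp_all add: unit_uniform_def uniform_measure_def)
  have pt: "emeasure (distr unit_uniform (count_space UNIV) h) {s} = ennreal (1 / L)" if "s \<in> S" for s
  proof -
    obtain k where k: "k < L" "s = e k" using e \<open>s \<in> S\<close> by (auto simp: bij_betw_def)
    have "x \<in> {0..<1} \<inter> h -` {s} \<longleftrightarrow> x \<in> {k / L..<(k + 1) / L}" for x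
    proof -
      have "h x = s \<longleftrightarrow> r x = k"
        using e k rL[of x] by (auto simp: h_def bij_betw_def inj_on_def)
      moreover have "r x = nat \<lfloor>real L * x\<rfloor>" if "x \<in> {0..<1}"
      proof -
        have "\<lfloor>real L * x\<rfloor> < int L" using that L by (simp add: floor_less_iff)
        then show ?thesis using L unfolding r_def by simp
      qed
      moreover have "nat \<lfloor>real L * x\<rfloor> = k \<longleftrightarrow> x \<in> {k / L..<(k + 1) / L}" if "x \<ge> 0"
      proof -
        have "nat \<lfloor>real L * x\<rfloor> = k \<longleftrightarrow> \<lfloor>real L * x\<rfloor> = int k" using that by auto
        also have "\<dots> \<longleftrightarrow> k \<le> real L * x \<and> real L * x < k + 1" by (simp add: floor_eq_iff add.commute)
        also have "\<dots> \<longleftrightarrow> x \<in> {k / L..<(k + 1) / L}" using L by (auto simp: field_simps)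
        finally show ?thesis .
      qed
      moreover have "x \<in> {0..<1}" if "x \<in> {k / L..<(k + 1) / L}"
      proof -
        have "0 \<le> k / L" "(k + 1) / L \<le> 1" using k by (auto simp: field_simps)
        with that show ?thesis unfolding atLeastLessThan_iff by linarith
      qed
      ultimately show ?thesis by auto
    qed
    then have eq: "{0..<1} \<inter> h -` {s} = {k / L..<(k + 1) / L}" by blast
    have "emeasure (distr unit_uniform (count_space UNIV) h) {s} = emeasure unit_uniform (h -` {s})"
      by (subst emeasure_distr[OF hm]) (auto simp: unit_uniform_def)
    also have "\<dots> = emeasure lborel ({0..<1} \<inter> h -` {s}) / emeasure lborel {0..<1::real}"
      using measurable_sets[OF hm, of "{s}"] unfolding unit_uniform_def by (subst emeasure_uniform_measure) auto
    also have "\<dots> = ennreal (1 / L)"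
      unfolding eq using L divide_ennreal[of "1 / L" 1] by (simp add: divide_right_mono flip: diff_divide_distrib)
    finally show ?thesis .
  qed
  have "distr unit_uniform (count_space UNIV) h = measure_pmf (pmf_of_set S)"
  proof (rule measure_eqI_countable_AE[where \<Omega>=S])
    show "AE x in distr unit_uniform (count_space UNIV) h. x \<in> S"
      using range by (subst AE_distr_iff[OF hm]) auto
    show "emeasure (distr unit_uniform (count_space UNIV) h) {a} = emeasure (measure_pmf (pmf_of_set S)) {a}"
      if "a \<in> S" for a
      using that S by (simp add: pt emeasure_pmf_single L_def)
  qed (use S in \<open>auto simp: AE_measure_pmf_iff countable_finite\<close>)
  with range hm show ?thesis by blast
qed

section \<open>A reverse Markov inequality and a birthday bound\<close>

text \<open>The number of occurring events has mean at least \<open>q * card I\<close>. It is at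
  most \<open>card I\<close> on the event in question and below \<open>c * card I\<close> off it;
  taking expectations and dividing by \<open>card I\<close> gives the bound.\<close>

lemma (in prob_space) prob_many_events_ge:
  fixes F :: "'i \<Rightarrow> 'a set" and q c :: real
  assumes I: "finite I" "I \<noteq> {}" and F: "\<And>i. i \<in> I \<Longrightarrow> F i \<in> events" "\<And>i. i \<in> I \<Longrightarrow> q \<le> prob (F i)"
    and c: "0 \<le> c" and E: "{x \<in> space M. c * card I \<le> card {i \<in> I. x \<in> F i}} \<in> events" (is "?E \<in> _")
  shows "q - c \<le> prob {x \<in> space M. c * card I \<le> card {i \<in> I. x \<in> F i}}"
proof -
  have cardI: "card I > 0" using I by (simp add: card_gt_0_iff)
  have "q * card I \<le> (\<Sum>i\<in>I. prob (F i))"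
    using sum_bounded_below[of I q "\<lambda>i. prob (F i)"] F(2) by (simp add: mult.commute)
  also have "\<dots> = expectation (\<lambda>x. \<Sum>i\<in>I. indicator (F i) x)"
    using F(1) sets.sets_into_space[OF F(1)]
    by (subst Bochner_Integration.integral_sum) (auto intro!: sum.cong simp: Int_absorb2 integrable_indicator_iff emeasure_eq_measure)
  also have "\<dots> \<le> expectation (\<lambda>x. real (card I) * indicator ?E x + c * card I)"
  proof (rule integral_mono)
    fix x assume x: "x \<in> space M"
    have "(\<Sum>i\<in>I. indicator (F i) x :: real) = card {i \<in> I. x \<in> F i}"
      using I(1) by (simp add: indicator_def sum.If_cases Int_def)
    moreover have "card {i \<in> I. x \<in> F i} \<le> card I" using I(1) by (intro card_mono) auto
    moreover have "card I \<le> card I + c * card I" "0 \<le> c * card I" using c by simp_all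
    ultimately show "(\<Sum>i\<in>I. indicator (F i) x) \<le> real (card I) * indicator ?E x + c * card I"
      using x by (cases "c * card I \<le> card {i \<in> I. x \<in> F i}") (simp_all only: indicator_def mem_Collect_eq, simp_all)
  qed (use F(1) E in \<open>auto simp: less_top[symmetric] intro!: integrable_real_indicator Bochner_Integration.integrable_sum Bochner_Integration.integrable_add\<close>)
  also have "\<dots> = card I * prob ?E + c * card I"
    using E by (subst Bochner_Integration.integral_add)
      (auto simp: prob_space less_top[symmetric] intro!: integrable_real_indicator)
  finally have "card I * (q - c) \<le> card I * prob ?E" by (simp add: algebra_simps)
  then show ?thesis using cardI by simp
qed

text \<open>Birthday bound by a union over ordered pairs of distinct indices and their common value:
  by independence each such event has probability \<open>1 / (card T)\<^sup>2\<close>, and there are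
  at most \<open>(card J)\<^sup>2 * card T\<close> of them.\<close>

lemma (in prob_space) PiM_collision_event:
  fixes u :: "'a \<Rightarrow> 'b"
  assumes J: "finite J" and T: "finite T" "\<And>x. x \<in> space M \<Longrightarrow> u x \<in> T"
    and u: "\<And>v. v \<in> T \<Longrightarrow> u -` {v} \<inter> space M \<in> events"
      "\<And>v. v \<in> T \<Longrightarrow> prob (u -` {v} \<inter> space M) = 1 / card T"
  shows "\<exists>X\<in>sets (\<Pi>\<^sub>M i\<in>J. M). measure (\<Pi>\<^sub>M i\<in>J. M) X \<le> (card J)\<^sup>2 / card T \<and>
    (\<forall>x\<in>space (\<Pi>\<^sub>M i\<in>J. M) - X. inj_on (\<lambda>i. u (x i)) J)"
proof -
  let ?P = "\<Pi>\<^sub>M i\<in>J. M"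
  interpret P: product_prob_space "\<lambda>_. M" J by unfold_locales
  \<comment> \<open>\<open>Y ((l, m), v)\<close> is the event that coordinates \<open>l\<close> and
    \<open>m\<close> both have value \<open>v\<close> under \<open>u\<close>.\<close>
  define Y where "Y = (\<lambda>((l, m), v). {x \<in> space ?P. \<forall>i\<in>{l, m}. x i \<in> u -` {v} \<inter> space M})"
  define K where "K = {(l, m). l \<in> J \<and> m \<in> J \<and> l \<noteq> m} \<times> T"
  have sub: "{(l, m). l \<in> J \<and> m \<in> J \<and> l \<noteq> m} \<subseteq> J \<times> J" by auto
  have finK: "finite K" unfolding K_def using J T finite_subset[OF sub] by auto
  have Ys: "Y k \<in> sets ?P" if "k \<in> K" for k
  proof -
    obtain l m v where k: "k = ((l, m), v)" by (cases k; cases "fst k") auto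
    have lm: "l \<in> J" "m \<in> J" "u -` {v} \<inter> space M \<in> events" using that u(1) by (auto simp: K_def k)
    have "Y k = (\<lambda>x. x l) -` (u -` {v} \<inter> space M) \<inter> space ?P \<inter> ((\<lambda>x. x m) -` (u -` {v} \<inter> space M) \<inter> space ?P)"
      by (auto simp: Y_def k)
    then show ?thesis
      using measurable_sets[OF measurable_component_singleton[of _ J] lm(3)] lm by auto
  qed
  have Yp: "measure ?P (Y k) = 1 / (card T)\<^sup>2" if "k \<in> K" for k
  proof -
    obtain l m v where k: "k = ((l, m), v)" by (cases k; cases "fst k") auto
    have lm: "l \<in> J" "m \<in> J" "l \<noteq> m" "v \<in> T" using that by (auto simp: K_def k)
    have "emeasure ?P (Y k) = (\<Prod>i\<in>{l, m}. emeasure M (u -` {v} \<inter> space M))"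
      unfolding Y_def k prod.case using lm u(1) by (intro P.emeasure_PiM_Collect) auto
    also have "\<dots> = ennreal (1 / (card T)\<^sup>2)"
      using lm u(2)[of v] by (simp add: emeasure_eq_measure ennreal_mult[symmetric] power2_eq_square)
    finally show ?thesis by (simp add: P.emeasure_eq_measure)
  qed
  show ?thesis
  proof (intro bexI conjI ballI)
    show "(\<Union>k\<in>K. Y k) \<in> sets ?P" using finK Ys by auto
    have "measure ?P (\<Union>k\<in>K. Y k) \<le> (\<Sum>k\<in>K. measure ?P (Y k))"
      using finK Ys by (intro P.finite_measure_subadditive_finite) auto
    also have "\<dots> = card K / (card T)\<^sup>2" using Yp by simp
    also have "\<dots> \<le> ((card J)\<^sup>2 * card T) / (card T)\<^sup>2"
    proof -
      have "card K \<le> card (J \<times> J) * card T"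
        unfolding K_def card_cartesian_product[of _ T] using J by (intro mult_right_mono card_mono sub) auto
      then have "card K \<le> (card J)\<^sup>2 * card T" by (simp add: card_cartesian_product power2_eq_square)
      then show ?thesis by (intro divide_right_mono) (simp_all flip: of_nat_power of_nat_mult)
    qed
    also have "\<dots> = (card J)\<^sup>2 / card T" by (simp add: power2_eq_square)
    finally show "measure ?P (\<Union>k\<in>K. Y k) \<le> (card J)\<^sup>2 / card T" .
    fix x assume x: "x \<in> space ?P - (\<Union>k\<in>K. Y k)"
    show "inj_on (\<lambda>i. u (x i)) J"
    proof (rule inj_onI, rule ccontr)
      fix l m assume lm: "l \<in> J" "m \<in> J" "u (x l) = u (x m)" "l \<noteq> m"
      then have "x l \<in> space M" "x m \<in> space M" using x by (auto simp: space_PiM)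
      then have "((l, m), u (x l)) \<in> K" "x \<in> Y ((l, m), u (x l))"
        using lm x T(2) by (auto simp: K_def Y_def)
      with x show False by blast
    qed
  qed
qed

section \<open>Neighborhood distances between labels\<close>

lemma finite_labels: "finite (labels N)"
  by (simp add: labels_def)

lemma card_labels: "card (labels N) = 3 * 2 ^ N * N"
  by (simp add: labels_def card_cartesian_product card_Pow)

lemma sum_labels: "(\<Sum>s\<in>labels N. f s) = (\<Sum>t<3. \<Sum>V\<in>Pow {..<N}. \<Sum>u<N. f (t, V, u))"
  by (simp add: labels_def sum.cartesian_product)

text \<open>The neighborhood distance of \<open>link\<close> under the uniform law on
  \<open>labels N\<close>.\<close>

definition label_dist :: "nat \<Rightarrow> label \<Rightarrow> label \<Rightarrow> real" where
  "label_dist N x y = sqrt ((\<Sum>s\<in>labels N. (link x s - link y s)\<^sup>2) / card (labels N))"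

lemma label_dist_le_1: "label_dist N x y \<le> 1"
proof -
  have "(link x s - link y s)\<^sup>2 \<le> 1" for s
    using link_bounds[of x s] link_bounds[of y s] by (simp add: abs_square_le_1 abs_le_iff)
  then have "(\<Sum>s\<in>labels N. (link x s - link y s)\<^sup>2) \<le> card (labels N)"
    using sum_bounded_above[of "labels N" "\<lambda>s. (link x s - link y s)\<^sup>2" 1] by simp
  then show ?thesis
    unfolding label_dist_def by (auto simp: divide_le_eq_1)
qed

lemma label_dist_0_0: "label_dist N (0, V, a) (0, U, b) = 0"
  by (simp add: label_dist_def link_def)

text \<open>The two rows differ only at probes, a third of all labels, and there by exactly
  \<open>1 / 2\<close>, whatever the mask: \<open>1 / 3 * 1 / 4 = 1 / 12\<close>.\<close>

lemma label_dist_0_1: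
  assumes "N > 0"
  shows "(label_dist N (0, V, a) (1, U, b))\<^sup>2 = 1 / 12"
proof -
  have *: "(link (0, V, a) s - link (1, U, b) s)\<^sup>2 = (if kind s = 2 then 1 / 4 else 0)" for s
    by (auto simp: link_def power2_eq_square)
  have "(\<Sum>s\<in>labels N. (link (0, V, a) s - link (1, U, b) s)\<^sup>2) = 2 ^ N * N / 4"
    unfolding * sum_labels by (simp add: numeral_3_eq_3 card_Pow)
  then have "(\<Sum>s\<in>labels N. (link (0, V, a) s - link (1, U, b) s)\<^sup>2) / card (labels N) = 1 / 12"
    using assms by (simp only: card_labels) (simp add: field_simps)
  then show ?thesis
    unfolding label_dist_def by (simp del: One_nat_def)
qed

section \<open>Indistinguishable kinds force an error\<close>

lemma adj_pmf_comp: "adj_pmf n (\<lambda>x y. f (h x) (h y)) \<omega> = adj_pmf n f (h \<circ> \<omega>)"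
  by (simp add: adj_pmf_def comp_def)

lemma nn_integral_pmf_of_set_real:
  assumes "finite S" "S \<noteq> {}" "\<And>x. 0 \<le> f x"
  shows "(\<integral>\<^sup>+x. ennreal (f x) \<partial>measure_pmf (pmf_of_set S)) = ennreal ((\<Sum>x\<in>S. f x) / card S)"
  using assms
  by (subst nn_integral_eq_integral) (simp_all add: integral_pmf_of_set integrable_measure_pmf_finite)

text \<open>Two-point argument for the label of node \<open>j\<close>, all others being fixed.
  \<open>B\<close> contains matrices on which the estimate fails for kind 0, and off
  \<open>B\<close> it fails for kind 1. The averaged law of the matrix is the same for both kinds,
  so the two failure probabilities sum to at least 1, and each kind makes up a third of the
  labels.\<close>

lemma sum_two_types_ge:
  assumes inj: "inj_on (\<lambda>l. position (g l)) ({1..n} - {j})"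
    and pos: "\<And>l. l \<in> {1..n} - {j} \<Longrightarrow> position (g l) < N"
    and P0: "\<And>V u A. A \<in> B \<Longrightarrow> P (g(j := (0, V, u))) A"
    and P1: "\<And>V u A. A \<notin> B \<Longrightarrow> P (g(j := (1, V, u))) A"
  shows "card (labels N) / 3 \<le>
    (\<Sum>s\<in>labels N. measure_pmf.prob (adj_pmf n link (g(j := s))) {A. P (g(j := s)) A})"
proof -
  define H where "H s = measure_pmf.prob (adj_pmf n link (g(j := s)))" for s
  have hide: "bind_pmf (pmf_of_set (Pow {..<N})) (\<lambda>V. adj_pmf n link (g(j := (1, V, u))))
      = adj_pmf n link (g(j := (0, U, v)))" for u U v
    by (rule adj_pmf_average_mask[OF inj]) (rule pos)
  \<comment> \<open>Both instances of \<open>hide\<close> have the same left-hand side, so under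
    kind 0 the mask and position of \<open>j\<close> do not affect the law.\<close>
  have H0: "H (0, V, u) C = H (0, {}, 0) C" for V u C
    using hide[of 0 V u] hide[of 0 "{}" 0] by (simp add: H_def)
  have H1: "(\<Sum>V\<in>Pow {..<N}. H (1, V, u) C) = 2 ^ N * H (0, {}, 0) C" for u C
  proof -
    have "ennreal (H (0, {}, 0) C) = emeasure (measure_pmf (adj_pmf n link (g(j := (0, {}, 0))))) C"
      by (simp add: H_def measure_pmf.emeasure_eq_measure)
    also have "\<dots> = (\<integral>\<^sup>+V. ennreal (H (1, V, u) C) \<partial>measure_pmf (pmf_of_set (Pow {..<N})))"
      unfolding hide[of u "{}" 0, symmetric] emeasure_bind_pmf
      by (simp add: H_def measure_pmf.emeasure_eq_measure)
    also have "\<dots> = ennreal ((\<Sum>V\<in>Pow {..<N}. H (1, V, u) C) / 2 ^ N)"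
      by (subst nn_integral_pmf_of_set_real) (simp_all add: Pow_not_empty card_Pow H_def)
    finally have "H (0, {}, 0) C = (\<Sum>V\<in>Pow {..<N}. H (1, V, u) C) / 2 ^ N"
      by (subst (asm) ennreal_inj) (auto simp: H_def intro!: sum_nonneg divide_nonneg_nonneg)
    then show ?thesis by (simp add: field_simps)
  qed
  have compl: "H (0, {}, 0) B + H (0, {}, 0) (- B) = 1"
    using measure_pmf.prob_compl[of B "adj_pmf n link (g(j := (0, {}, 0)))"]
    by (simp add: H_def Compl_eq_Diff_UNIV)
  have "card (labels N) / 3 = N * (2 ^ N * (H (0, {}, 0) B + H (0, {}, 0) (- B)))"
    by (simp add: card_labels compl)
  also have "\<dots> = (\<Sum>u<N. \<Sum>V\<in>Pow {..<N}. H (0, V, u) B) + (\<Sum>u<N. \<Sum>V\<in>Pow {..<N}. H (1, V, u) (- B))"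
    unfolding H1 by (subst H0) (simp add: card_Pow algebra_simps)
  also have "\<dots> = (\<Sum>V\<in>Pow {..<N}. \<Sum>u<N. H (0, V, u) B) + (\<Sum>V\<in>Pow {..<N}. \<Sum>u<N. H (1, V, u) (- B))"
    by (simp add: sum.swap[of _ _ "{..<N}"])
  also have "\<dots> \<le> (\<Sum>V\<in>Pow {..<N}. \<Sum>u<N. H (0, V, u) {A. P (g(j := (0, V, u))) A})
      + (\<Sum>V\<in>Pow {..<N}. \<Sum>u<N. H (1, V, u) {A. P (g(j := (1, V, u))) A})"
    unfolding H_def
    by (intro add_mono sum_mono measure_pmf.finite_measure_mono) (use P0 P1 in auto)
  \<comment> \<open>The nonnegative contribution of kind 2 is added.\<close>
  also have "\<dots> \<le> (\<Sum>t<3. \<Sum>V\<in>Pow {..<N}. \<Sum>u<N. H (t, V, u) {A. P (g(j := (t, V, u))) A})"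
    by (simp add: numeral_3_eq_3 H_def sum_nonneg)
  finally show ?thesis unfolding sum_labels H_def .
qed

section \<open>The graphon on the real line and measurability of sample events\<close>

definition link_of :: "('a \<Rightarrow> label) \<Rightarrow> 'a \<Rightarrow> 'a \<Rightarrow> real" where
  "link_of h x y = link (h x) (h y)"

text \<open>The range condition holds everywhere, not just almost surely, so that a sample has only
  finitely many label patterns.\<close>

locale labelled_unit = prob_space M for M :: "real measure" +
  fixes h :: "real \<Rightarrow> label" and N :: nat
  assumes N_pos: "N > 0"
    and h_measurable [measurable]: "h \<in> M \<rightarrow>\<^sub>M count_space UNIV"
    and h_range: "range h \<subseteq> labels N"
    and distr_h: "distr M (count_space UNIV) h = measure_pmf (pmf_of_set (labels N))"
begin

abbreviation W :: "real \<Rightarrow> real \<Rightarrow> real" where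
  "W \<equiv> link_of h"

lemma labels_ne: "labels N \<noteq> {}"
  using h_range by auto

lemma nn_integral_h:
  assumes "\<And>s. 0 \<le> f s"
  shows "(\<integral>\<^sup>+x. ennreal (f (h x)) \<partial>M) = ennreal ((\<Sum>s\<in>labels N. f s) / card (labels N))"
  using assms
  by (subst nn_integral_distr[of h M "count_space UNIV" "\<lambda>s. ennreal (f s)", symmetric])
     (simp_all add: distr_h nn_integral_pmf_of_set_real finite_labels labels_ne)

lemma prob_h: "prob (h -` T \<inter> space M) = card (labels N \<inter> T) / card (labels N)"
  using measure_distr[OF h_measurable, of T]
  by (simp add: distr_h measure_pmf_of_set finite_labels labels_ne)

lemma nb_dist_W: "nb_dist M W x y = label_dist N (h x) (h y)"
proof -
  have "(\<integral>z. \<bar>W x z - W y z\<bar>\<^sup>2 \<partial>M) = (\<integral>s. (link (h x) s - link (h y) s)\<^sup>2 \<partial>distr M (count_space UNIV) h)"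
    by (subst integral_distr) (simp_all add: link_of_def)
  then show ?thesis
    by (simp add: nb_dist_def label_dist_def distr_h integral_pmf_of_set finite_labels labels_ne)
qed

lemma graphon_W: "graphon M W"
proof -
  have "(\<lambda>z. link (h (fst z)) (h (snd z))) \<in> borel_measurable (M \<Otimes>\<^sub>M M)"
  \<comment> \<open>The first label takes finitely many values, so it may be frozen at a constant
    \<open>s\<close>, which leaves a function of the second label alone.\<close>
  proof (rule measurable_compose_countable'[where g = "\<lambda>z. h (fst z)" and I = "labels N"])
    fix s
    show "(\<lambda>z. link s (h (snd z))) \<in> borel_measurable (M \<Otimes>\<^sub>M M)"
      by (rule measurable_compose[of "\<lambda>z. h (snd z)" _ "count_space UNIV"]) simp_all
    have "h \<in> M \<rightarrow>\<^sub>M count_space (labels N)"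
      using h_range measurable_sets[OF h_measurable]
      by (subst measurable_count_space_eq2[OF finite_labels]) auto
    then show "(\<lambda>z. h (fst z)) \<in> M \<Otimes>\<^sub>M M \<rightarrow>\<^sub>M count_space (labels N)"
      by (rule measurable_compose[OF measurable_fst])
  qed (simp add: finite_labels countable_finite)
  then show ?thesis
    using prob_space_axioms by (simp add: graphon_def link_of_def case_prod_beta' link_bounds link_commute)
qed

text \<open>A point of the product space is \<open>undefined\<close> off \<open>J\<close>, so
  composing with \<open>h\<close> gives \<open>h undefined\<close> there; hence this default
  value.\<close>

abbreviation pat :: "nat set \<Rightarrow> (nat \<Rightarrow> label) set" where
  "pat J \<equiv> PiE_dflt J (h undefined) (\<lambda>_. labels N)"

lemma comp_h_measurable:
  assumes J: "finite J"
  shows "(\<lambda>\<omega>. h \<circ> \<omega>) \<in> (\<Pi>\<^sub>M i\<in>J. M) \<rightarrow>\<^sub>M count_space (pat J)"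
proof (subst measurable_count_space_eq2)
  show "finite (pat J)" using J finite_labels by auto
  have "(\<lambda>\<omega>. h \<circ> \<omega>) -` {g} \<inter> space (\<Pi>\<^sub>M i\<in>J. M) \<in> sets (\<Pi>\<^sub>M i\<in>J. M)" if g: "g \<in> pat J" for g
  proof -
    have "(\<lambda>\<omega>. h \<circ> \<omega>) -` {g} \<inter> space (\<Pi>\<^sub>M i\<in>J. M) = {\<omega> \<in> space (\<Pi>\<^sub>M i\<in>J. M). \<forall>i\<in>J. h (\<omega> i) = g i}"
      using g by (auto simp: fun_eq_iff PiE_dflt_def space_PiM PiE_def extensional_def) metis
    also have "\<dots> \<in> sets (\<Pi>\<^sub>M i\<in>J. M)"
      by (rule sets.sets_Collect_finite_All[OF _ J]) measurable
    finally show ?thesis .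
  qed
  then show "(\<lambda>\<omega>. h \<circ> \<omega>) \<in> space (\<Pi>\<^sub>M i\<in>J. M) \<rightarrow> pat J \<and>
      (\<forall>g\<in>pat J. (\<lambda>\<omega>. h \<circ> \<omega>) -` {g} \<inter> space (\<Pi>\<^sub>M i\<in>J. M) \<in> sets (\<Pi>\<^sub>M i\<in>J. M))"
    using h_range by (auto simp: PiE_dflt_def space_PiM PiE_def extensional_def)
qed

end

section \<open>Failure probability of a single pair\<close>

lemma card_labels_kind_0: "card (labels N \<inter> {s. kind s = 0}) = 2 ^ N * N"
proof -
  have "labels N \<inter> {s. kind s = 0} = {0} \<times> Pow {..<N} \<times> {..<N}" by (auto simp: labels_def)
  then show ?thesis by (simp add: card_cartesian_product card_Pow)
qed

lemma card_labels_position: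
  assumes "v < N"
  shows "card (labels N \<inter> {s. position s = v}) = 3 * 2 ^ N"
proof -
  have "labels N \<inter> {s. position s = v} = {..<3} \<times> Pow {..<N} \<times> {v}" using assms by (auto simp: labels_def)
  then show ?thesis by (simp add: card_cartesian_product card_Pow)
qed

context labelled_unit
begin

lemma position_h: "position (h x) < N"
proof -
  have "h x \<in> labels N" using h_range by blast
  then show ?thesis by (auto simp: labels_def)
qed

text \<open>\<open>P\<close> is arbitrary, as it must be for an arbitrary estimator: positions enter
  through finitely many label patterns, and every set of matrices is measurable.\<close>

lemma sample_event_measurable:
  "{z \<in> space (sample_space n M). P (h \<circ> fst z) (snd z)} \<in> sets (sample_space n M)"
proof -
  have "(\<lambda>z. P (h \<circ> fst z) (snd z)) \<in> sample_space n M \<rightarrow>\<^sub>M count_space UNIV"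
  proof (rule measurable_compose_countable'[where f = "\<lambda>g z. P g (snd z)" and g = "\<lambda>z. h \<circ> fst z"])
    show "(\<lambda>z. h \<circ> fst z) \<in> sample_space n M \<rightarrow>\<^sub>M count_space (pat {1..n})"
      unfolding sample_space_def
      by (rule measurable_compose[OF measurable_fst comp_h_measurable]) simp
    show "(\<lambda>z. P g (snd z)) \<in> sample_space n M \<rightarrow>\<^sub>M count_space UNIV" for g
      unfolding sample_space_def by (rule measurable_compose[OF measurable_snd]) simp
  qed (intro countable_finite finite_PiE_dflt, auto simp: finite_labels)
  then show ?thesis by (simp add: pred_def)
qed

text \<open>Node \<open>i\<close> has kind 0 with probability \<open>1 / 3\<close>; removing a
  collision event of probability at most \<open>1 / 6\<close> leaves \<open>1 / 6\<close>.\<close>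

lemma prob_kind_0_positions_distinct:
  assumes J: "finite J" "i \<in> J" "6 * (card J)\<^sup>2 \<le> N"
  shows "\<exists>R\<in>sets (\<Pi>\<^sub>M i\<in>J. M). 1 / 6 \<le> measure (\<Pi>\<^sub>M i\<in>J. M) R \<and>
    (\<forall>x\<in>R. kind (h (x i)) = 0 \<and> inj_on (\<lambda>l. position (h (x l))) J)"
proof -
  let ?P = "\<Pi>\<^sub>M i\<in>J. M"
  interpret P: product_prob_space "\<lambda>_. M" J by unfold_locales
  have "\<exists>X\<in>sets ?P. measure ?P X \<le> (card J)\<^sup>2 / card {..<N} \<and>
      (\<forall>x\<in>space ?P - X. inj_on (\<lambda>i. position (h (x i))) J)"
  proof (rule PiM_collision_event[OF J(1)])
    fix v assume v: "v \<in> {..<N}"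
    have eq: "(\<lambda>x. position (h x)) -` {v} \<inter> space M = h -` {s. position s = v} \<inter> space M" by auto
    show "(\<lambda>x. position (h x)) -` {v} \<inter> space M \<in> events"
      unfolding eq by (rule measurable_sets[OF h_measurable]) simp
    show "prob ((\<lambda>x. position (h x)) -` {v} \<inter> space M) = 1 / card {..<N}"
      unfolding eq prob_h using v by (simp add: card_labels_position card_labels)
  qed (use position_h in auto)
  then obtain X where X: "X \<in> sets ?P" "measure ?P X \<le> (card J)\<^sup>2 / N"
    "\<And>x. x \<in> space ?P - X \<Longrightarrow> inj_on (\<lambda>i. position (h (x i))) J" by auto
  define Z where "Z = {x \<in> space ?P. x i \<in> h -` {s. kind s = 0} \<inter> space M}"
  have hZ: "h -` {s. kind s = 0} \<inter> space M \<in> events" by (rule measurable_sets[OF h_measurable]) simp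
  have Z: "Z \<in> sets ?P" unfolding Z_def
    using measurable_sets[OF measurable_component_singleton[OF J(2)] hZ] by (simp add: vimage_def Int_def conj_ac)
  have "emeasure ?P Z = emeasure M (h -` {s. kind s = 0} \<inter> space M)"
    unfolding Z_def by (rule P.emeasure_PiM_Collect_single[OF J(2) hZ])
  then have "measure ?P Z = prob (h -` {s. kind s = 0} \<inter> space M)" by (simp add: measure_def)
  then have "measure ?P Z = 1 / 3"
    unfolding prob_h using N_pos by (simp add: card_labels_kind_0 card_labels)
  moreover have "measure ?P Z \<le> measure ?P (Z - X) + measure ?P X"
    using P.finite_measure_mono[of Z "(Z - X) \<union> X"] measure_Un_le[of "Z - X" ?P X] X(1) Z by auto
  moreover have "(card J)\<^sup>2 / N \<le> 1 / 6"
    using J(3) N_pos by (simp add: field_simps flip: of_nat_power of_nat_mult)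
  ultimately have "1 / 6 \<le> measure ?P (Z - X)" using X(2) by linarith
  then show ?thesis
    using X Z by (intro bexI[of _ "Z - X"]) (auto simp: Z_def)
qed

text \<open>Condition on all nodes but \<open>j\<close>. With probability at least
  \<open>1 / 6\<close> node \<open>i\<close> has kind 0 and the positions are distinct; then the
  random label of \<open>j\<close> causes failure with probability at least
  \<open>1 / 3\<close>.\<close>

lemma prob_pair_event_ge:
  fixes P :: "(nat \<Rightarrow> label) \<Rightarrow> (nat \<Rightarrow> nat \<Rightarrow> bool) \<Rightarrow> bool"
  assumes ij: "i \<in> {1..n}" "j \<in> {1..n}" "i \<noteq> j" and N: "6 * n\<^sup>2 \<le> N"
    and P0: "\<And>g V u A. kind (g i) = 0 \<Longrightarrow> A \<in> B \<Longrightarrow> P (g(j := (0, V, u))) A"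
    and P1: "\<And>g V u A. kind (g i) = 0 \<Longrightarrow> A \<notin> B \<Longrightarrow> P (g(j := (1, V, u))) A"
  shows "1 / 18 \<le> measure (w_random_graph n M W)
    {z \<in> space (w_random_graph n M W). P (h \<circ> fst z) (snd z)}"
proof -
  let ?Q = "w_random_graph n M W" and ?I = "{1..n}" and ?J = "{1..n} - {j}"
  let ?P = "\<Pi>\<^sub>M i\<in>?I. M" and ?PJ = "\<Pi>\<^sub>M i\<in>?J. M"
  interpret P: product_prob_space "\<lambda>_. M" ?I by unfold_locales
  interpret PJ: product_prob_space "\<lambda>_. M" ?J by unfold_locales
  interpret Q: prob_space ?Q by (rule prob_space_w_random_graph[OF graphon_W])
  have spQ: "space ?Q = space (sample_space n M)"
    by (rule sets_eq_imp_space_eq[OF prob_space_w_random_graph(2)[OF graphon_W]])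
  define F where "F = {z \<in> space (sample_space n M). P (h \<circ> fst z) (snd z)}"
  have F: "F \<in> sets (sample_space n M)" unfolding F_def by (rule sample_event_measurable)
  define H where "H g = measure_pmf.prob (adj_pmf n link g) {A. P g A}" for g
  have H_nonneg: "0 \<le> H g" for g by (simp add: H_def)
  have ins: "insert j ?J = ?I" using ij by auto
  have Hm: "(\<lambda>\<omega>. ennreal (H (h \<circ> \<omega>))) \<in> borel_measurable ?P"
    by (rule measurable_compose[OF comp_h_measurable]) simp_all
  have spP: "space ?P \<noteq> {}" by (rule P.not_empty)
  have "emeasure ?Q F =
      (\<integral>\<^sup>+\<omega>. emeasure (distr (measure_pmf (adj_pmf n W \<omega>)) (sample_space n M) (Pair \<omega>)) F \<partial>?P)"
    unfolding w_random_graph_def by (rule emeasure_bind[OF spP w_random_kernel_measurable[OF graphon_W] F])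
  also have "\<dots> = (\<integral>\<^sup>+\<omega>. ennreal (H (h \<circ> \<omega>)) \<partial>?P)"
  proof (rule nn_integral_cong)
    fix \<omega> assume w: "\<omega> \<in> space ?P"
    have adj: "adj_pmf n W \<omega> = adj_pmf n link (h \<circ> \<omega>)"
      using adj_pmf_comp[of n link h \<omega>] by (simp add: link_of_def[abs_def])
    have "Pair \<omega> \<in> measure_pmf (adj_pmf n W \<omega>) \<rightarrow>\<^sub>M sample_space n M"
      using w by (auto simp: sample_space_def space_pair_measure)
    then have "emeasure (distr (measure_pmf (adj_pmf n W \<omega>)) (sample_space n M) (Pair \<omega>)) F
        = emeasure (measure_pmf (adj_pmf n W \<omega>)) (Pair \<omega> -` F)"
      using F by (simp add: emeasure_distr)
    also have "Pair \<omega> -` F = {A. P (h \<circ> \<omega>) A}"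
      using w by (auto simp: F_def sample_space_def space_pair_measure)
    also have "emeasure (measure_pmf (adj_pmf n W \<omega>)) \<dots> = ennreal (H (h \<circ> \<omega>))"
      unfolding H_def adj
      by (rule measure_pmf.emeasure_eq_measure)
    finally show "emeasure (distr (measure_pmf (adj_pmf n W \<omega>)) (sample_space n M) (Pair \<omega>)) F = ennreal (H (h \<circ> \<omega>))" .
  qed
  \<comment> \<open>Fubini: the position of node \<open>j\<close> is integrated out first, with the
    others held fixed.\<close>
  also have "\<dots> = (\<integral>\<^sup>+x. (\<integral>\<^sup>+y. ennreal (H (h \<circ> x(j := y))) \<partial>M) \<partial>?PJ)"
    using P.product_nn_integral_insert[of ?J j "\<lambda>\<omega>. ennreal (H (h \<circ> \<omega>))"] Hm
    unfolding ins by simp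
  finally have emQ: "emeasure ?Q F = \<dots>" .
  have "card ?J \<le> n" using ij by simp
  then have "6 * (card ?J)\<^sup>2 \<le> 6 * n\<^sup>2" by (intro mult_left_mono power_mono) auto
  then have "6 * (card ?J)\<^sup>2 \<le> N" using N by linarith
  moreover have "i \<in> ?J" using ij by simp
  ultimately obtain R where R: "R \<in> sets ?PJ" "1 / 6 \<le> measure ?PJ R"
    "\<And>x. x \<in> R \<Longrightarrow> kind (h (x i)) = 0 \<and> inj_on (\<lambda>l. position (h (x l))) ?J"
    using prob_kind_0_positions_distinct[of ?J i] by auto
  have "ennreal (1 / 18) \<le> ennreal (1 / 3 * measure ?PJ R)" using R(2) by (intro ennreal_leI) simp
  also have "\<dots> = (\<integral>\<^sup>+x. ennreal (1 / 3) * indicator R x \<partial>?PJ)"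
    unfolding nn_integral_cmult_indicator[OF R(1)] PJ.emeasure_eq_measure by (rule ennreal_mult) auto
  also have "\<dots> \<le> (\<integral>\<^sup>+x. (\<integral>\<^sup>+y. ennreal (H (h \<circ> x(j := y))) \<partial>M) \<partial>?PJ)"
  proof (rule nn_integral_mono)
    fix x
    show "ennreal (1 / 3) * indicator R x \<le> (\<integral>\<^sup>+y. ennreal (H (h \<circ> x(j := y))) \<partial>M)"
    proof (cases "x \<in> R")
      case True
      have "card (labels N) / 3 \<le> (\<Sum>s\<in>labels N. H ((h \<circ> x)(j := s)))"
        unfolding H_def
      proof (rule sum_two_types_ge)
        show "inj_on (\<lambda>l. position ((h \<circ> x) l)) ?J" using R(3)[OF True] by simp
        show "position ((h \<circ> x) l) < N" for l by (simp add: position_h)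
        show "P ((h \<circ> x)(j := (0, V, u))) A" if "A \<in> B" for V u A
          using R(3)[OF True] that by (intro P0) auto
        show "P ((h \<circ> x)(j := (1, V, u))) A" if "A \<notin> B" for V u A
          using R(3)[OF True] that by (intro P1) auto
      qed
      moreover have "card (labels N) > 0" using N_pos by (simp add: card_labels)
      ultimately have "1 / 3 \<le> (\<Sum>s\<in>labels N. H ((h \<circ> x)(j := s))) / card (labels N)"
        by (simp add: field_simps)
      moreover have "(\<integral>\<^sup>+y. ennreal (H (h \<circ> x(j := y))) \<partial>M)
          = ennreal ((\<Sum>s\<in>labels N. H ((h \<circ> x)(j := s))) / card (labels N))"
        unfolding fun_upd_comp by (rule nn_integral_h) (rule H_nonneg)
      ultimately show ?thesis using True by (simp add: ennreal_leI)
    qed simp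
  qed
  also have "\<dots> = ennreal (measure ?Q F)" using emQ by (simp add: Q.emeasure_eq_measure)
  finally have "1 / 18 \<le> measure ?Q F" by simp
  then show ?thesis by (simp add: F_def spQ)
qed

end

section \<open>Choice of the constants and count of the failing pairs\<close>

theorem theorem8:
  "\<exists>(M :: real measure) (W :: nat \<Rightarrow> real \<Rightarrow> real \<Rightarrow> real) (p :: real) (c :: real) (c' :: real).
     p > 0 \<and> c > 0 \<and> c' > 0 \<and>
     (\<forall>n. graphon M (W n)) \<and>
     (\<forall>n\<ge>2. \<forall>(d :: (nat \<Rightarrow> nat \<Rightarrow> bool) \<Rightarrow> nat \<Rightarrow> nat \<Rightarrow> real) \<sigma>.
        \<sigma> permutes {1..n} \<longrightarrow>
        measure (w_random_graph n M (W n))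
          {(\<omega>, A) \<in> space (w_random_graph n M (W n)).
             c * real n \<le> real (card {(i, j). i \<in> {1..n} \<and> j \<in> {1..n} \<and> i \<noteq> j \<and>
               \<bar>(nb_dist M (W n) (\<omega> i) (\<omega> j))\<^sup>2 - (d A (\<sigma> i) (\<sigma> j))\<^sup>2\<bar>
                 \<ge> c' * (nb_dist M (W n) (\<omega> j) (\<omega> (nearest M (W n) n \<omega> j))
                        + nb_dist M (W n) (\<omega> i) (\<omega> (nearest M (W n) n \<omega> i))
                        + sqrt (ln (real n) / real n))})} > p)"
proof -
  \<comment> \<open>The birthday bound asks for at least \<open>6 * n\<^sup>2\<close> positions. The
    added 1 keeps the label set nonempty at \<open>n = 0\<close>, where a graphon is still
    required.\<close>
  define N where "N n = 6 * n\<^sup>2 + 1" for n :: nat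
  have "\<exists>h. range h \<subseteq> labels (N n) \<and> h \<in> unit_uniform \<rightarrow>\<^sub>M count_space UNIV \<and>
      distr unit_uniform (count_space UNIV) h = measure_pmf (pmf_of_set (labels (N n)))" for n
    by (rule unit_uniform_map_onto_finite) (auto simp: finite_labels labels_def N_def lessThan_empty_iff)
  then obtain h where h: "\<And>n. range (h n) \<subseteq> labels (N n)" "\<And>n. h n \<in> unit_uniform \<rightarrow>\<^sub>M count_space UNIV"
    "\<And>n. distr unit_uniform (count_space UNIV) (h n) = measure_pmf (pmf_of_set (labels (N n)))"
    by metis
  define W where "W n = link_of (h n)" for n
  have lab: "labelled_unit unit_uniform (h n) (N n)" for n
    using h[of n] by (intro labelled_unit.intro labelled_unit_axioms.intro prob_space_unit_uniform) (auto simp: N_def)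
  have graphon: "graphon unit_uniform (W n)" for n
    unfolding W_def by (rule labelled_unit.graphon_W[OF lab])
  have main: "1 / 72 < measure (w_random_graph n unit_uniform (W n))
      {(\<omega>, A) \<in> space (w_random_graph n unit_uniform (W n)).
         1 / 36 * real n \<le> real (card {(i, j). i \<in> {1..n} \<and> j \<in> {1..n} \<and> i \<noteq> j \<and>
           \<bar>(nb_dist unit_uniform (W n) (\<omega> i) (\<omega> j))\<^sup>2 - (d A (\<sigma> i) (\<sigma> j))\<^sup>2\<bar>
             \<ge> 1 / 72 * (nb_dist unit_uniform (W n) (\<omega> j) (\<omega> (nearest unit_uniform (W n) n \<omega> j))
                    + nb_dist unit_uniform (W n) (\<omega> i) (\<omega> (nearest unit_uniform (W n) n \<omega> i))
                    + sqrt (ln (real n) / real n))})}"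
    if n: "n \<ge> 2" for n and d :: "(nat \<Rightarrow> nat \<Rightarrow> bool) \<Rightarrow> nat \<Rightarrow> nat \<Rightarrow> real" and \<sigma>
  proof -
    interpret labelled_unit unit_uniform "h n" "N n" by (rule lab)
    let ?r = "label_dist (N n)"
    let ?Q = "w_random_graph n unit_uniform (W n)"
    interpret Q: prob_space ?Q by (rule prob_space_w_random_graph[OF graphon])
    have setsQ: "sets ?Q = sets (sample_space n unit_uniform)"
      by (rule prob_space_w_random_graph(2)[OF graphon])
    have spQ: "space ?Q = space (sample_space n unit_uniform)" by (rule sets_eq_imp_space_eq[OF setsQ])
    have nb: "nb_dist unit_uniform (W n) x y = ?r (h n x) (h n y)" for x y
      unfolding W_def by (rule nb_dist_W)
    \<comment> \<open>Restating the nearest neighbor through labels makes the failure of a pair a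
      function of \<open>h n \<circ> \<omega>\<close> and the matrix, the form in which events are
      measurable.\<close>
    define near where "near g i = arg_min_on (\<lambda>t. ?r (g i) (g t)) ({1..n} - {i})" for g :: "nat \<Rightarrow> label" and i
    define P where "P i j g A \<longleftrightarrow> \<bar>(?r (g i) (g j))\<^sup>2 - (d A (\<sigma> i) (\<sigma> j))\<^sup>2\<bar>
        \<ge> 1 / 72 * (?r (g j) (g (near g j)) + ?r (g i) (g (near g i)) + sqrt (ln (real n) / real n))" for i j g A
    define I where "I = {(i, j). i \<in> {1..n} \<and> j \<in> {1..n} \<and> i \<noteq> j}"
    define F where "F = (\<lambda>(i, j). {z \<in> space ?Q. P i j (h n \<circ> fst z) (snd z)})"
    define G where "G \<omega> A = {(i, j). i \<in> {1..n} \<and> j \<in> {1..n} \<and> i \<noteq> j \<and>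
           \<bar>(nb_dist unit_uniform (W n) (\<omega> i) (\<omega> j))\<^sup>2 - (d A (\<sigma> i) (\<sigma> j))\<^sup>2\<bar>
             \<ge> 1 / 72 * (nb_dist unit_uniform (W n) (\<omega> j) (\<omega> (nearest unit_uniform (W n) n \<omega> j))
                    + nb_dist unit_uniform (W n) (\<omega> i) (\<omega> (nearest unit_uniform (W n) n \<omega> i))
                    + sqrt (ln (real n) / real n))}" for \<omega> A
    have G: "{q \<in> I. (\<omega>, A) \<in> F q} = G \<omega> A" if "(\<omega>, A) \<in> space ?Q" for \<omega> A
      using that by (auto simp: F_def I_def G_def P_def near_def nearest_def nb comp_def)
    have sqrt_le: "sqrt (ln (real n) / real n) \<le> 1"
      using n ln_le_minus_one[of "real n"] by (simp add: divide_le_eq_1)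
    \<comment> \<open>Each of the three terms in the bracket is at most 1, so the factor
      \<open>1 / 72\<close> brings the threshold down to \<open>3 / 72 = 1 / 24\<close>, half of the
      gap \<open>1 / 12\<close> between the two possible squared distances.\<close>
    have PI: "P i j g A" if "1 / 24 \<le> \<bar>(?r (g i) (g j))\<^sup>2 - (d A (\<sigma> i) (\<sigma> j))\<^sup>2\<bar>" for i j g A
    proof -
      have third: "1 / 72 * (a + b + c) \<le> 1 / 24" if "a \<le> 1" "b \<le> 1" "c \<le> 1" for a b c :: real
        using that by simp
      have "1 / 72 * (?r (g j) (g (near g j)) + ?r (g i) (g (near g i)) + sqrt (ln (real n) / real n)) \<le> 1 / 24"
        by (intro third label_dist_le_1 sqrt_le)
      with that show ?thesis unfolding P_def by (rule order_trans[rotated])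
    qed
    have F_ge: "1 / 18 \<le> measure ?Q (F q)" if "q \<in> I" for q
    proof -
      obtain i j where q: "q = (i, j)" by (cases q)
      have ij: "i \<in> {1..n}" "j \<in> {1..n}" "i \<noteq> j" using that by (auto simp: I_def q)
      show ?thesis unfolding F_def q prod.case W_def
      \<comment> \<open>A squared estimate of at least \<open>1 / 24\<close> is too far from the
        value 0 of kind 0; a smaller one is too far from the value \<open>1 / 12\<close> of kind
        1.\<close>
      proof (rule prob_pair_event_ge[OF ij, where B = "{A. 1 / 24 \<le> (d A (\<sigma> i) (\<sigma> j))\<^sup>2}"])
        show "6 * n\<^sup>2 \<le> N n" by (simp add: N_def)
        fix g :: "nat \<Rightarrow> label" and V u A assume g: "kind (g i) = 0"
        then obtain U v where gi: "g i = (0, U, v)" by (cases "g i") auto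
        show "P i j (g(j := (0, V, u))) A" if "A \<in> {A. 1 / 24 \<le> (d A (\<sigma> i) (\<sigma> j))\<^sup>2}"
          by (rule PI) (use that ij in \<open>simp add: gi label_dist_0_0\<close>)
        show "P i j (g(j := (1, V, u))) A" if "A \<notin> {A. 1 / 24 \<le> (d A (\<sigma> i) (\<sigma> j))\<^sup>2}"
          by (rule PI) (use that ij label_dist_0_1[OF N_pos, of U v V u] in \<open>simp add: gi\<close>)
      qed
    qed
    have "I = {1..n} \<times> {1..n} - (\<lambda>i. (i, i)) ` {1..n}" by (auto simp: I_def)
    then have finI: "finite I" and "card I = n * n - n"
      by (auto simp: card_Diff_subset image_subset_iff card_image inj_on_def card_cartesian_product)
    \<comment> \<open>There are \<open>n * (n - 1)\<close> ordered pairs, at least \<open>n\<close>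
      of them because \<open>n \<ge> 2\<close>; a fraction of all pairs thus yields the required
      multiple of \<open>n\<close>.\<close>
    then have cardI: "n \<le> card I" using n by (cases n) (auto simp: algebra_simps)
    have "(1, 2) \<in> I" using n by (simp add: I_def)
    then have neI: "I \<noteq> {}" by blast
    have ev: "{z \<in> space ?Q. T (h n \<circ> fst z) (snd z)} \<in> sets ?Q" for T
      unfolding setsQ spQ by (rule sample_event_measurable)
    have cardF: "card {q \<in> I. z \<in> F q} = card {(i, j). (i, j) \<in> I \<and> P i j (h n \<circ> fst z) (snd z)}"
      if "z \<in> space ?Q" for z
      using that by (intro arg_cong[where f = card]) (auto simp: F_def)
    have E: "{z \<in> space ?Q. 1 / 36 * real (card I) \<le> real (card {q \<in> I. z \<in> F q})} \<in> sets ?Q"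
      using ev[of "\<lambda>g A. 1 / 36 * real (card I) \<le> real (card {(i, j). (i, j) \<in> I \<and> P i j g A})"]
      by (simp add: cardF cong: conj_cong)
    have E': "{z \<in> space ?Q. 1 / 36 * real n \<le> real (card {q \<in> I. z \<in> F q})} \<in> sets ?Q"
      using ev[of "\<lambda>g A. 1 / 36 * real n \<le> real (card {(i, j). (i, j) \<in> I \<and> P i j g A})"]
      by (simp add: cardF cong: conj_cong)
    \<comment> \<open>Asking for a fraction \<open>1 / 36\<close> of the pairs costs
      \<open>1 / 36\<close> of the probability \<open>1 / 18\<close>; the remaining
      \<open>1 / 36\<close> strictly exceeds \<open>p = 1 / 72\<close>.\<close>
    have "1 / 18 - 1 / 36 \<le> measure ?Q {z \<in> space ?Q. 1 / 36 * real (card I) \<le> real (card {q \<in> I. z \<in> F q})}"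
      using finI neI F_ge E by (intro Q.prob_many_events_ge) (auto simp: F_def ev)
    also have "\<dots> \<le> measure ?Q {z \<in> space ?Q. 1 / 36 * real n \<le> real (card {q \<in> I. z \<in> F q})}"
      using cardI E' by (intro Q.finite_measure_mono) auto
    also have "{z \<in> space ?Q. 1 / 36 * real n \<le> real (card {q \<in> I. z \<in> F q})} =
        {(\<omega>, A) \<in> space ?Q. 1 / 36 * real n \<le> real (card (G \<omega> A))}"
      by (auto simp: G)
    finally show ?thesis unfolding G_def by linarith
  qed
  show ?thesis
    by (rule exI[of _ unit_uniform], rule exI[of _ W], rule exI[of _ "1 / 72"], rule exI[of _ "1 / 36"],
        rule exI[of _ "1 / 72"], intro conjI allI impI graphon main) simp_all
qed

end
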